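(* Let $G$ be a countable group such that every finitely generated subgroup of $G$ has polynomial growth. Let $X$ be an aperiodic $G$-subshift, and let $Y$ be a nonempty $G$-subshift with the finite extension property. Then there exists a homomorphism $\phi : X \to Y$, i.e. a continuous map $\phi: X\to Y$ that commutes with the shift actions of $G$.
   Context: A finitely generated group $H$ has polynomial growth if there are a finite generating set $K$ and constants $C,d>0$ such that $|B_n(K)| \le C n^d$ for all $n\ge 1$, where $B_n(K)$ is the ball of radius $n$ about the identity in the word metric of $K$. Let $G$ be a countable group with identity $e$. For a finite nonempty set (alphabet) $\mathcal{A}$ with the discrete topology, $\mathcal{A}^G$ carries the product topology, and $G$ acts by the shift $(\sigma^g x)(h) = x(g^{-1}h)$. A $G$-subshift is a closed set $X \subset \mathcal{A}^G$ (for some finite alphabet $\mathcal{A}$) with $\sigma^g(X)=X$ for all $g\in G$. Different subshifts may have different alphabets. A point $x$ is aperiodic if $\sigma^g x = x$ implies $g=e$; a subshift is aperiodic if all of its points are aperiodic. A homomorphism between subshifts is a continuous map $\phi$ with $\phi\circ\sigma^g=\sigma^g\circ\phi$ for all $g \in G$. Patterns: for $S\subset G$ (possibly infinite or empty), a pattern of shape $S$ is an element $w\in\mathcal{A}^S$; for $S'\subset S$, $w(S')$ denotes the restriction of $w$ to $S'$. For $g\in G$ and $w\in \mathcal{A}^S$, $g\cdot w\in\mathcal{A}^{gS}$ is given by $(g\cdot w)(gs)=w(s)$ for $s \in S$. For finite $K\subset G$ and $\mathcal{F}\subset\mathcal{A}^K$, let $X_{\mathcal{F}}=\{x\in\mathcal{A}^G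 : \forall g\in G,\ (\sigma^g x)(K)\notin\mathcal{F}\}$. Finite extension property (FEP): a $G$-subshift $X$ with alphabet $\mathcal{A}$ has the FEP if there exist a finite set $K\subset G$ containing $e$ and a collection $\mathcal{F}\subset\mathcal{A}^K$ such that $X=X_{\mathcal{F}}$ and, for every $S\subset G$ and every $w\in\mathcal{A}^S$, if there exists $w'\in\mathcal{A}^{SK}$ with $w'(S)=w$ and $g^{-1}\cdot w'(gK)\notin\mathcal{F}$ for all $g\in S$, then there exists $x\in X$ with $x(S)=w$. *)

theory Defs
  imports "HOL-Analysis.Analysis" "HOL-Algebra.Generated_Groups"
begin

section \<open>Word metric and growth\<close>

definition word_length :: "('g, 'm) monoid_scheme \<Rightarrow> 'g set \<Rightarrow> 'g \<Rightarrow> nat" where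
  \<comment> \<open>Meaningful only for elements of the subgroup generated by \<open>K\<close>; it is used below
      only when \<open>K\<close> generates \<open>H\<close>.\<close>
  "word_length H K g =
     (LEAST n. \<exists>ws. length ws = n \<and> set ws \<subseteq> K \<union> (\<lambda>k. inv\<^bsub>H\<^esub> k) ` K
                  \<and> foldr (\<otimes>\<^bsub>H\<^esub>) ws \<one>\<^bsub>H\<^esub> = g)"

definition word_dist :: "('g, 'm) monoid_scheme \<Rightarrow> 'g set \<Rightarrow> 'g \<Rightarrow> 'g \<Rightarrow> nat" where
  "word_dist H K g h = word_length H K (inv\<^bsub>H\<^esub> g \<otimes>\<^bsub>H\<^esub> h)"

definition word_ball :: "('g, 'm) monoid_scheme \<Rightarrow> 'g set \<Rightarrow> nat \<Rightarrow> 'g set" where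
  "word_ball H K n = {h \<in> carrier H. word_dist H K \<one>\<^bsub>H\<^esub> h \<le> n}"

definition generating_set :: "('g, 'm) monoid_scheme \<Rightarrow> 'g set \<Rightarrow> bool" where
  "generating_set H K \<longleftrightarrow> K \<subseteq> carrier H \<and> generate H K = carrier H"

definition finitely_generated :: "('g, 'm) monoid_scheme \<Rightarrow> bool" where
  "finitely_generated H \<longleftrightarrow> (\<exists>K. finite K \<and> generating_set H K)"

definition polynomial_growth :: "('g, 'm) monoid_scheme \<Rightarrow> bool" where
  "polynomial_growth H \<longleftrightarrow>
     (\<exists>K C d. finite K \<and> generating_set H K \<and> (C::real) > 0 \<and> (d::real) > 0 \<and>
        (\<forall>n\<ge>1. real (card (word_ball H K n)) \<le> C * real n powr d))"

section \<open>Subshifts\<close>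

text \<open>For \<open>S \<subseteq> carrier G\<close>, patterns of shape \<open>S\<close> over the alphabet \<open>A\<close> are the elements of
  \<open>S \<rightarrow>\<^sub>E A\<close>, i.e. functions that are \<open>undefined\<close> off \<open>S\<close>; the full shift is the case
  \<open>S = carrier G\<close>, and \<open>w(S')\<close> is \<open>restrict w S'\<close>.\<close>

definition full_shift_top :: "('g, 'm) monoid_scheme \<Rightarrow> 'a set \<Rightarrow> ('g \<Rightarrow> 'a) topology" where
  "full_shift_top G A = product_topology (\<lambda>_. discrete_topology A) (carrier G)"

definition shift :: "('g, 'm) monoid_scheme \<Rightarrow> 'g \<Rightarrow> ('g \<Rightarrow> 'a) \<Rightarrow> 'g \<Rightarrow> 'a" where
  "shift G g x = (\<lambda>h\<in>carrier G. x (inv\<^bsub>G\<^esub> g \<otimes>\<^bsub>G\<^esub> h))"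

definition subshift :: "('g, 'm) monoid_scheme \<Rightarrow> 'a set \<Rightarrow> ('g \<Rightarrow> 'a) set \<Rightarrow> bool" where
  "subshift G A X \<longleftrightarrow>
     finite A \<and> A \<noteq> {} \<and> closedin (full_shift_top G A) X \<and>
     (\<forall>g\<in>carrier G. shift G g ` X = X)"

definition aperiodic_point :: "('g, 'm) monoid_scheme \<Rightarrow> ('g \<Rightarrow> 'a) \<Rightarrow> bool" where
  "aperiodic_point G x \<longleftrightarrow> (\<forall>g\<in>carrier G. shift G g x = x \<longrightarrow> g = \<one>\<^bsub>G\<^esub>)"

definition aperiodic :: "('g, 'm) monoid_scheme \<Rightarrow> ('g \<Rightarrow> 'a) set \<Rightarrow> bool" where
  "aperiodic G X \<longleftrightarrow> (\<forall>x\<in>X. aperiodic_point G x)"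

definition subshift_hom ::
  "('g, 'm) monoid_scheme \<Rightarrow> 'a set \<Rightarrow> ('g \<Rightarrow> 'a) set \<Rightarrow> 'b set \<Rightarrow> ('g \<Rightarrow> 'b) set
     \<Rightarrow> (('g \<Rightarrow> 'a) \<Rightarrow> ('g \<Rightarrow> 'b)) \<Rightarrow> bool" where
  "subshift_hom G A X B Y \<phi> \<longleftrightarrow>
     continuous_map (subtopology (full_shift_top G A) X) (subtopology (full_shift_top G B) Y) \<phi> \<and>
     (\<forall>g\<in>carrier G. \<forall>x\<in>X. \<phi> (shift G g x) = shift G g (\<phi> x))"

section \<open>Patterns and the finite extension property\<close>

definition translate ::
  "('g, 'm) monoid_scheme \<Rightarrow> 'g \<Rightarrow> 'g set \<Rightarrow> ('g \<Rightarrow> 'a) \<Rightarrow> 'g \<Rightarrow> 'a" where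
  \<comment> \<open>\<open>g \<cdot> w\<close> for a pattern \<open>w\<close> of shape \<open>S\<close>; its shape is \<open>gS\<close>.\<close>
  "translate G g S w = (\<lambda>h\<in>g <#\<^bsub>G\<^esub> S. w (inv\<^bsub>G\<^esub> g \<otimes>\<^bsub>G\<^esub> h))"

definition forbidden_shift ::
  "('g, 'm) monoid_scheme \<Rightarrow> 'a set \<Rightarrow> 'g set \<Rightarrow> ('g \<Rightarrow> 'a) set \<Rightarrow> ('g \<Rightarrow> 'a) set" where
  "forbidden_shift G A K F =
     {x \<in> carrier G \<rightarrow>\<^sub>E A. \<forall>g\<in>carrier G. restrict (shift G g x) K \<notin> F}"

definition FEP :: "('g, 'm) monoid_scheme \<Rightarrow> 'a set \<Rightarrow> ('g \<Rightarrow> 'a) set \<Rightarrow> bool" where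
  "FEP G A X \<longleftrightarrow>
     (\<exists>K F. finite K \<and> K \<subseteq> carrier G \<and> \<one>\<^bsub>G\<^esub> \<in> K \<and> F \<subseteq> (K \<rightarrow>\<^sub>E A) \<and>
        X = forbidden_shift G A K F \<and>
        (\<forall>S w. S \<subseteq> carrier G \<and> w \<in> (S \<rightarrow>\<^sub>E A) \<and>
           (\<exists>w' \<in> (S <#>\<^bsub>G\<^esub> K) \<rightarrow>\<^sub>E A. restrict w' S = w \<and>
              (\<forall>g\<in>S. translate G (inv\<^bsub>G\<^esub> g) (g <#\<^bsub>G\<^esub> K) (restrict w' (g <#\<^bsub>G\<^esub> K)) \<notin> F))
           \<longrightarrow> (\<exists>x\<in>X. restrict x S = w)))"

end

theory Submission
  imports Defs
begin

text \<open>
  Write \<open>view x g\<close> for the point \<open>x\<close> seen from \<open>g\<close>, that is \<open>h \<mapsto> x (g \<otimes> h)\<close>. An equivariant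
  continuous map out of \<open>X\<close> is the same as a function \<open>V\<close> on \<open>X\<close> that depends only on a finite
  window: the symbol written at \<open>g\<close> is \<open>V (view x g)\<close>. So the image configuration may be
  constructed in any finite number of stages, as long as each stage consults the point and the
  earlier stages only within a bounded distance.

  Aperiodicity and compactness give, for every finite \<open>D\<close>, a window whose content distinguishes
  each site from its other \<open>D\<close>-neighbours. The contents of the window form a finite proper
  colouring, and processing one colour after another yields a maximal \<open>D\<close>-separated set of
  sites inside any locally defined set of sites (\<open>maximal_separated\<close>).

  The configuration in \<open>Y\<close> is written inside balls. Suppose that it has been written around a set
  of sites so that no forbidden pattern is anchored in a neighbourhood of it. By the finite extension
  property the configuration on that neighbourhood extends to a point of \<open>Y\<close>, so a further ball
  can be filled from such an extension. Balls that are far apart are filled simultaneously and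
  independently. Each such stage costs one unit of the margin by which the neighbourhood
  surpasses the set of sites (\<open>fill_separated_balls\<close>).

  It follows that the number \<open>M\<close> of stages has to be known before the distance between the balls
  is fixed, and this is where growth enters. For the subgroup generated by the window of \<open>Y\<close>,
  polynomial growth provides one constant \<open>M\<close> and arbitrarily large radii \<open>r\<close> with
  \<open>\<bar>b (8 r)\<bar> < M \<bar>b r\<bar>\<close>. At such a scale a greedy choice of \<open>M\<close> families of \<open>6 r\<close>-separated
  centres covers all sites by balls of radius \<open>2 r\<close>, because a site left over would have \<open>M\<close>
  centres near it with disjoint balls of radius \<open>r\<close> (\<open>separated_ball_cover\<close>). Taking \<open>r > M\<close>
  leaves room for all the margins.
\<close>

section \<open>Ball systems and polynomial growth\<close>

text \<open>
  The properties of the balls of a word metric that matter later. They are kept separate from the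
  word metric itself because the balls generate only a subgroup: on the rest of the group
  the distance is infinite, and \<open>ball_system_subgroup\<close> passes to the whole group at no cost.
\<close>

locale ball_system = group G for G (structure) +
  fixes b :: "nat \<Rightarrow> 'a set"
  assumes ball_finite: "finite (b n)"
    and ball_carrier: "b n \<subseteq> carrier G"
    and ball_one: "\<one> \<in> b n"
    and ball_inv: "g \<in> b n \<Longrightarrow> inv g \<in> b n"
    and ball_mult: "g \<in> b m \<Longrightarrow> h \<in> b n \<Longrightarrow> g \<otimes> h \<in> b (m + n)"
begin

lemma ball_mono: "m \<le> n \<Longrightarrow> b m \<subseteq> b n"
proof
  fix g assume "m \<le> n" "g \<in> b m"
  then show "g \<in> b n"
    using ball_mult[of g m \<one> "n - m"] ball_one ball_carrier by fastforce
qed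

lemma ball_mem_carrier: "g \<in> b n \<Longrightarrow> g \<in> carrier G"
  using ball_carrier by blast

end

context group
begin

lemma mult_inv_cancel:
  assumes "g \<in> carrier G" and "h \<in> carrier G"
  shows "g \<otimes> (inv g \<otimes> h) = h" and "inv g \<otimes> (g \<otimes> h) = h"
  using assms by (simp_all flip: m_assoc)

lemma foldr_mult_closed: "set ws \<subseteq> carrier G \<Longrightarrow> foldr (\<otimes>) ws \<one> \<in> carrier G"
  by (induction ws) auto

lemma foldr_mult_append:
  "set us \<subseteq> carrier G \<Longrightarrow> set vs \<subseteq> carrier G \<Longrightarrow>
    foldr (\<otimes>) (us @ vs) \<one> = foldr (\<otimes>) us \<one> \<otimes> foldr (\<otimes>) vs \<one>"
  by (induction us) (auto simp: foldr_mult_closed m_assoc simp del: foldr_append)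

lemma foldr_mult_inv:
  "set ws \<subseteq> carrier G \<Longrightarrow>
    foldr (\<otimes>) (rev (map (m_inv G) ws)) \<one> = inv (foldr (\<otimes>) ws \<one>)"
proof (induction ws)
  case (Cons a ws)
  have "set (rev (map (m_inv G) ws)) \<subseteq> carrier G" using Cons.prems by auto
  then have "foldr (\<otimes>) (rev (map (m_inv G) ws) @ [inv a]) \<one>
      = foldr (\<otimes>) (rev (map (m_inv G) ws)) \<one> \<otimes> foldr (\<otimes>) [inv a] \<one>"
    using Cons.prems by (intro foldr_mult_append) auto
  then show ?case
    using Cons by (simp add: foldr_mult_closed inv_mult_group del: foldr_append)
qed simp

lemma generating_set_word:
  assumes "generating_set G K" and "g \<in> carrier G"
  shows "\<exists>ws. set ws \<subseteq> K \<union> m_inv G ` K \<and> foldr (\<otimes>) ws \<one> = g"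
proof -
  have K: "K \<subseteq> carrier G" and "g \<in> generate G K"
    using assms by (auto simp: generating_set_def)
  from this(2) show ?thesis
  proof (induction rule: generate.induct)
    case one
    show ?case by (intro exI[of _ "[]"]) simp
  next
    case (incl h)
    then show ?case using K by (intro exI[of _ "[h]"]) auto
  next
    case (inv h)
    then show ?case using K by (intro exI[of _ "[inv h]"]) auto
  next
    case (eng g h)
    then obtain us vs where "set us \<subseteq> K \<union> m_inv G ` K" "foldr (\<otimes>) us \<one> = g"
      "set vs \<subseteq> K \<union> m_inv G ` K" "foldr (\<otimes>) vs \<one> = h" by blast
    moreover have "K \<union> m_inv G ` K \<subseteq> carrier G" using K by auto
    ultimately show ?case
      using foldr_mult_append[of us vs]
      by (intro exI[of _ "us @ vs"]) (auto simp del: foldr_append)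
  qed
qed

lemma word_ball_iff:
  assumes K: "generating_set G K"
  shows "g \<in> word_ball G K n \<longleftrightarrow>
    (\<exists>ws. length ws \<le> n \<and> set ws \<subseteq> K \<union> m_inv G ` K \<and> foldr (\<otimes>) ws \<one> = g)"
    (is "_ \<longleftrightarrow> (\<exists>ws. _ \<and> ?word ws)")
proof
  assume "g \<in> word_ball G K n"
  then have g: "g \<in> carrier G" and le: "word_length G K g \<le> n"
    by (auto simp: word_ball_def word_dist_def)
  from generating_set_word[OF K g] have "\<exists>m ws. length ws = m \<and> ?word ws" by blast
  then have "\<exists>ws. length ws = word_length G K g \<and> ?word ws"
    unfolding word_length_def by (rule LeastI_ex)
  then obtain ws where "length ws = word_length G K g" "?word ws" by blast
  then show "\<exists>ws. length ws \<le> n \<and> ?word ws" using le by (intro exI[of _ ws]) simp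
next
  assume "\<exists>ws. length ws \<le> n \<and> ?word ws"
  then obtain ws where ws: "length ws \<le> n" "?word ws" by blast
  have "K \<union> m_inv G ` K \<subseteq> carrier G" using K by (auto simp: generating_set_def)
  then have "set ws \<subseteq> carrier G" using ws(2) by (blast intro: subset_trans)
  then have "g \<in> carrier G" using ws(2) foldr_mult_closed by blast
  moreover have "word_length G K g \<le> length ws"
    unfolding word_length_def using ws(2) by (intro Least_le) blast
  ultimately show "g \<in> word_ball G K n"
    using ws(1) by (simp add: word_ball_def word_dist_def)
qed

lemma ball_system_word_ball:
  assumes K: "generating_set G K" and "finite K"
  shows "ball_system G (\<lambda>n. word_ball G K (a * n))"
proof (unfold_locales, goal_cases)
  case (1 n)
  let ?L = "{ws. set ws \<subseteq> K \<union> m_inv G ` K \<and> length ws \<le> a * n}"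
  have "finite ?L" using \<open>finite K\<close> by (intro finite_lists_length_le) auto
  moreover have "word_ball G K (a * n) \<subseteq> (\<lambda>ws. foldr (\<otimes>) ws \<one>) ` ?L"
    using word_ball_iff[OF K] by (auto simp: image_iff) metis
  ultimately show ?case by (rule finite_surj)
next
  case (2 n)
  show ?case by (auto simp: word_ball_def)
next
  case (3 n)
  show ?case unfolding word_ball_iff[OF K] by (intro exI[of _ "[]"]) simp
next
  case (4 g n)
  then obtain ws where ws: "length ws \<le> a * n" "set ws \<subseteq> K \<union> m_inv G ` K"
    "foldr (\<otimes>) ws \<one> = g" unfolding word_ball_iff[OF K] by blast
  have KG: "K \<subseteq> carrier G" using K by (simp add: generating_set_def)
  have "m_inv G ` (K \<union> m_inv G ` K) \<subseteq> K \<union> m_inv G ` K" using KG by force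
  then have "set (rev (map (m_inv G) ws)) \<subseteq> K \<union> m_inv G ` K"
    using image_mono[OF ws(2), of "m_inv G"] by simp
  moreover have "set ws \<subseteq> carrier G" using ws(2) KG by force
  ultimately show ?case
    unfolding word_ball_iff[OF K] using foldr_mult_inv[of ws] ws
    by (intro exI[of _ "rev (map (m_inv G) ws)"]) auto
next
  case (5 g m h n)
  then obtain us vs where uv: "length us \<le> a * m" "set us \<subseteq> K \<union> m_inv G ` K"
    "foldr (\<otimes>) us \<one> = g" "length vs \<le> a * n" "set vs \<subseteq> K \<union> m_inv G ` K"
    "foldr (\<otimes>) vs \<one> = h" unfolding word_ball_iff[OF K] by blast
  have "K \<union> m_inv G ` K \<subseteq> carrier G" using K by (auto simp: generating_set_def)
  then have "set us \<subseteq> carrier G" "set vs \<subseteq> carrier G" using uv by auto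
  then show ?case
    unfolding word_ball_iff[OF K] using foldr_mult_append[of us vs] uv
    by (intro exI[of _ "us @ vs"]) (auto simp: algebra_simps simp del: foldr_append)
qed

end

text \<open>
  If \<open>f\<close> grew by the factor \<open>M > 8 powr d\<close> at every multiplication of a large argument by \<open>8\<close>, then
  along the sequence \<open>8 ^ k * N\<close> it would outgrow every multiple of the \<open>d\<close>-th power. This gives
  the bound at arbitrarily large scales only, not at all of them.
\<close>

lemma polynomially_bounded_imp_doubling_scales:
  fixes f :: "nat \<Rightarrow> nat" and C d :: real
  assumes pos: "\<And>n. f n > 0" and bound: "\<And>n. n \<ge> 1 \<Longrightarrow> real (f n) \<le> C * real n powr d"
  shows "\<exists>M. \<forall>n0. \<exists>n\<ge>n0. f (8 * n) < M * f n"
proof -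
  obtain M :: nat where M: "real M > 8 powr d" using reals_Archimedean2 by blast
  have "\<exists>n\<ge>n0. f (8 * n) < M * f n" for n0
  proof (rule ccontr)
    assume "\<not> ?thesis"
    then have grow: "f (8 * n) \<ge> M * f n" if "n \<ge> n0" for n using that by (meson not_le)
    define N where "N = max n0 1"
    have N: "N \<ge> n0" "N \<ge> 1" by (auto simp: N_def)
    have ge: "M ^ k \<le> f (8 ^ k * N)" for k
    proof (induction k)
      case 0
      show ?case using pos[of N] by simp
    next
      case (Suc k)
      have "N \<le> 8 ^ k * N" by simp
      then have "n0 \<le> 8 ^ k * N" using N by linarith
      then have "M * f (8 ^ k * N) \<le> f (8 * (8 ^ k * N))" by (rule grow)
      moreover have "M * M ^ k \<le> M * f (8 ^ k * N)" using Suc by (rule mult_le_mono2)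
      ultimately have "M * M ^ k \<le> f (8 * (8 ^ k * N))" by (rule le_trans[rotated])
      then show ?case by (simp add: mult.assoc)
    qed
    have "(real M / 8 powr d) ^ k \<le> C * real N powr d" for k
    proof -
      have "real M ^ k \<le> real (f (8 ^ k * N))" using ge[of k] by (metis of_nat_le_iff of_nat_power)
      also have "\<dots> \<le> C * real (8 ^ k * N) powr d" using N by (intro bound) simp
      also have "\<dots> = C * real N powr d * (8 powr d) ^ k"
        by (simp add: powr_mult powr_power powr_powr mult.commute flip: powr_realpow)
      finally show ?thesis by (simp add: power_divide divide_simps)
    qed
    moreover have "real M / 8 powr d > 1" using M by simp
    ultimately show False using real_arch_pow[of "real M / 8 powr d" "C * real N powr d"]
      by (meson not_le)
  qed
  then show ?thesis by blast
qed

lemma (in group) polynomial_growth_doubling_balls: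
  assumes "polynomial_growth G" and "finite K" and "K \<subseteq> carrier G"
  obtains b M where "ball_system G b" and "K \<subseteq> b 1"
    and "\<forall>n0. \<exists>n\<ge>n0. card (b (8 * n)) < M * card (b n)"
proof -
  obtain J C d where J: "finite J" "generating_set G J" and C: "(C::real) > 0" "(d::real) > 0"
    and bound: "\<forall>n\<ge>1. real (card (word_ball G J n)) \<le> C * real n powr d"
    using assms(1) unfolding polynomial_growth_def by blast
  \<comment> \<open>Rescaling the radius makes the unit ball large enough to contain \<open>K\<close>.\<close>
  define a where "a = Suc (\<Sum>k\<in>K. word_length G J k)"
  define b where "b = (\<lambda>n. word_ball G J (a * n))"
  interpret ball_system G b unfolding b_def using J by (intro ball_system_word_ball)
  have "K \<subseteq> b 1"
  proof
    fix k assume k: "k \<in> K"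
    then have "word_length G J k \<le> (\<Sum>k\<in>K. word_length G J k)"
      using \<open>finite K\<close> by (intro member_le_sum) auto
    then show "k \<in> b 1" using k \<open>K \<subseteq> carrier G\<close>
      by (auto simp: b_def a_def word_ball_def word_dist_def)
  qed
  moreover have "\<exists>M. \<forall>n0. \<exists>n\<ge>n0. card (b (8 * n)) < M * card (b n)"
  proof (rule polynomially_bounded_imp_doubling_scales)
    show "card (b n) > 0" for n using ball_finite ball_one by (auto simp: card_gt_0_iff)
    show "real (card (b n)) \<le> (C * real a powr d) * real n powr d" if "n \<ge> 1" for n
    proof -
      have "a * n \<ge> 1" using that by (simp add: a_def)
      then have "real (card (b n)) \<le> C * real (a * n) powr d"
        unfolding b_def using bound by blast
      then show ?thesis by (simp add: powr_mult mult.assoc)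
    qed
  qed
  ultimately show ?thesis using that ball_system_axioms by blast
qed

lemma (in group) ball_system_subgroup:
  assumes H: "subgroup H G" and "ball_system (G\<lparr>carrier := H\<rparr>) b"
  shows "ball_system G b"
proof -
  interpret B: ball_system "G\<lparr>carrier := H\<rparr>" b by fact
  have mem: "b n \<subseteq> H" for n using B.ball_carrier by simp
  show ?thesis
  proof (unfold_locales, goal_cases)
    case (4 g n)
    then have "inv\<^bsub>G\<lparr>carrier := H\<rparr>\<^esub> g = inv g" using mem H m_inv_consistent by blast
    with B.ball_inv[OF 4] show ?case by simp
  next
    case (2 n)
    show ?case using mem[of n] subgroup.subset[OF H] by blast
  qed (use B.ball_finite B.ball_one B.ball_mult in auto)
qed

section \<open>Local functions on a subshift\<close>

locale group_subshift = group G for G :: "('g, 'm) monoid_scheme" (structure) +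
  fixes A :: "'a set" and X :: "('g \<Rightarrow> 'a) set"
  assumes subshift: "subshift G A X"
begin

definition view :: "('g \<Rightarrow> 'a) \<Rightarrow> 'g \<Rightarrow> 'g \<Rightarrow> 'a" where
  "view x g = shift G (inv g) x"

lemma view_apply: "g \<in> carrier G \<Longrightarrow> h \<in> carrier G \<Longrightarrow> view x g h = x (g \<otimes> h)"
  by (simp add: view_def shift_def)

lemma view_view:
  "g \<in> carrier G \<Longrightarrow> h \<in> carrier G \<Longrightarrow> view (view x g) h = view x (g \<otimes> h)"
  by (auto simp: view_def shift_def fun_eq_iff m_assoc)

lemma X_subset_full: "X \<subseteq> carrier G \<rightarrow>\<^sub>E A"
  using subshift closedin_subset[of "full_shift_top G A" X]
  by (simp add: subshift_def full_shift_top_def)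

lemma view_one: "x \<in> X \<Longrightarrow> view x \<one> = x"
  using X_subset_full by (fastforce simp: view_def shift_def fun_eq_iff PiE_def extensional_def)

lemma view_in: "x \<in> X \<Longrightarrow> g \<in> carrier G \<Longrightarrow> view x g \<in> X"
  using subshift unfolding subshift_def view_def by (metis imageI inv_closed)

lemma view_inv_cancel:
  "x \<in> X \<Longrightarrow> g \<in> carrier G \<Longrightarrow> view (view x g) (inv g) = x"
  by (simp add: view_view view_one)

text \<open>
  Locally constant functions on \<open>X\<close>, in the form used for sliding block codes. The codomain is an
  arbitrary type, so a local function may itself return a pattern or a point of another subshift.
\<close>

definition local :: "(('g \<Rightarrow> 'a) \<Rightarrow> 'c) \<Rightarrow> bool" where
  "local F \<longleftrightarrow> (\<exists>W. finite W \<and> W \<subseteq> carrier G \<and>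
     (\<forall>x\<in>X. \<forall>y\<in>X. (\<forall>w\<in>W. x w = y w) \<longrightarrow> F x = F y))"

lemma local_const: "local (\<lambda>_. c)"
  unfolding local_def by (intro exI[of _ "{}"]) simp

lemma local_restrict: "finite W \<Longrightarrow> W \<subseteq> carrier G \<Longrightarrow> local (\<lambda>x. restrict x W)"
  unfolding local_def by (intro exI[of _ W]) (auto intro!: restrict_ext)

lemma local_pair:
  assumes "local F" and "local F'"
  shows "local (\<lambda>x. (F x, F' x))"
proof -
  obtain W W' where
    "finite W" "W \<subseteq> carrier G" "\<forall>x\<in>X. \<forall>y\<in>X. (\<forall>w\<in>W. x w = y w) \<longrightarrow> F x = F y"
    "finite W'" "W' \<subseteq> carrier G" "\<forall>x\<in>X. \<forall>y\<in>X. (\<forall>w\<in>W'. x w = y w) \<longrightarrow> F' x = F' y"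
    using assms unfolding local_def by blast
  then show ?thesis unfolding local_def by (intro exI[of _ "W \<union> W'"]) blast
qed

text \<open>
  Apart from pairing, closure properties of local functions come from this one: whatever is fixed by
  the values of a local function at finitely many sites is local, with window the product of the
  set of sites and the old window. It applies to definitions by \<open>SOME\<close> as well, since equal
  predicates have equal choices.
\<close>

lemma local_rule:
  assumes F: "local F" and D: "finite D" "D \<subseteq> carrier G"
    and H: "\<And>x y. \<lbrakk>x \<in> X; y \<in> X; \<And>d. d \<in> D \<Longrightarrow> F (view x d) = F (view y d)\<rbrakk> \<Longrightarrow> H x = H y"
  shows "local H"
proof -
  obtain W where W: "finite W" "W \<subseteq> carrier G"
    and FW: "\<forall>x\<in>X. \<forall>y\<in>X. (\<forall>w\<in>W. x w = y w) \<longrightarrow> F x = F y"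
    using F unfolding local_def by blast
  define W' where "W' = (\<lambda>(d, w). d \<otimes> w) ` (D \<times> W)"
  have "H x = H y" if xy: "x \<in> X" "y \<in> X" and eq: "\<forall>w\<in>W'. x w = y w" for x y
  proof (rule H[OF xy])
    fix d assume d: "d \<in> D"
    have "view x d w = view y d w" if "w \<in> W" for w
    proof -
      have "d \<otimes> w \<in> W'" using d that by (force simp: W'_def)
      then show ?thesis using eq d that D W by (auto simp: view_apply subset_iff)
    qed
    then show "F (view x d) = F (view y d)" using FW view_in xy d D by blast
  qed
  moreover have "finite W'" "W' \<subseteq> carrier G" using D W by (auto simp: W'_def)
  ultimately show ?thesis unfolding local_def by blast
qed

lemma cylinder_open:
  assumes "finite W" and "W \<subseteq> carrier G" and "x \<in> carrier G \<rightarrow>\<^sub>E A"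
  shows "openin (full_shift_top G A) {y \<in> carrier G \<rightarrow>\<^sub>E A. \<forall>w\<in>W. y w = x w}"
proof -
  have "{y \<in> carrier G \<rightarrow>\<^sub>E A. \<forall>w\<in>W. y w = x w}
      = (\<Pi>\<^sub>E g\<in>carrier G. if g \<in> W then {x g} else A)"
    using assms by (auto simp: PiE_iff extensional_def split: if_splits)
  also have "openin (full_shift_top G A) \<dots>"
    unfolding full_shift_top_def using assms
    by (intro product_topology_basis) (auto intro: finite_subset[OF _ \<open>finite W\<close>] split: if_splits)
  finally show ?thesis .
qed

lemma compact_X: "compactin (full_shift_top G A) X"
proof -
  have "compact_space (full_shift_top G A)"
    using subshift unfolding full_shift_top_def subshift_def
    by (auto simp: compact_space_product_topology compact_space_discrete_topology)
  then show ?thesis using subshift closedin_compact_space by (auto simp: subshift_def)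
qed

text \<open>
  The easy direction of the Curtis--Hedlund--Lyndon theorem: every coordinate of the image is
  constant on cylinders, and reading \<open>V\<close> at the translates of a point is equivariant by
  construction.
\<close>

lemma local_imp_hom:
  fixes V :: "('g \<Rightarrow> 'a) \<Rightarrow> 'b"
  assumes V: "local V" and Y: "\<And>x. x \<in> X \<Longrightarrow> (\<lambda>g\<in>carrier G. V (view x g)) \<in> Y"
    and YB: "Y \<subseteq> carrier G \<rightarrow>\<^sub>E B"
  shows "subshift_hom G A X B Y (\<lambda>x. \<lambda>g\<in>carrier G. V (view x g))"
proof -
  let ?\<phi> = "\<lambda>x. \<lambda>g\<in>carrier G. V (view x g)"
  let ?T = "subtopology (full_shift_top G A) X"
  have top: "topspace ?T = X"
    using X_subset_full by (auto simp: full_shift_top_def)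
  have comp: "continuous_map ?T (discrete_topology B) (\<lambda>x. ?\<phi> x g)" if g: "g \<in> carrier G" for g
  proof -
    have "local (\<lambda>x. ?\<phi> x g)"
      by (rule local_rule[OF V, of "{g}"]) (use g in auto)
    then obtain W where W: "finite W" "W \<subseteq> carrier G"
      and eq: "\<forall>x\<in>X. \<forall>y\<in>X. (\<forall>w\<in>W. x w = y w) \<longrightarrow> ?\<phi> x g = ?\<phi> y g"
      unfolding local_def by blast
    have "openin ?T {x \<in> X. ?\<phi> x g \<in> U}" for U
    proof (subst openin_subopen, clarify)
      fix x assume x: "x \<in> X" "?\<phi> x g \<in> U"
      let ?C = "{y \<in> carrier G \<rightarrow>\<^sub>E A. \<forall>w\<in>W. y w = x w}"
      have "openin ?T (?C \<inter> X)"
        using x X_subset_full by (intro openin_subtopology_Int cylinder_open W) blast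
      moreover have "x \<in> ?C \<inter> X" using x X_subset_full by blast
      moreover have "?C \<inter> X \<subseteq> {x \<in> X. ?\<phi> x g \<in> U}"
      proof clarify
        fix y assume y: "y \<in> X" "\<forall>w\<in>W. y w = x w"
        then have "?\<phi> y g = ?\<phi> x g" using eq x by blast
        then show "?\<phi> y g \<in> U" using x by metis
      qed
      ultimately show "\<exists>T. openin ?T T \<and> x \<in> T \<and> T \<subseteq> {x \<in> X. ?\<phi> x g \<in> U}" by blast
    qed
    moreover have "?\<phi> x g \<in> B" if "x \<in> X" for x using Y[OF that] YB g by blast
    ultimately show ?thesis unfolding continuous_map_def top by auto
  qed
  have "continuous_map ?T (subtopology (full_shift_top G B) Y) ?\<phi>"
    unfolding continuous_map_in_subtopology
  proof
    show "continuous_map ?T (full_shift_top G B) ?\<phi>"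
      unfolding full_shift_top_def[of G B] continuous_map_componentwise
      using comp by (auto simp: extensional_def)
    show "?\<phi> \<in> topspace ?T \<rightarrow> Y" using Y top by auto
  qed
  moreover have "?\<phi> (shift G g x) = shift G g (?\<phi> x)" if "g \<in> carrier G" "x \<in> X" for g x
  proof -
    have eq: "shift G g x = view x (inv g)" using that by (simp add: view_def)
    have "?\<phi> (view x (inv g)) = shift G g (?\<phi> x)"
      using that by (auto simp: view_view shift_def[of G g "?\<phi> x"] fun_eq_iff)
    then show ?thesis unfolding eq .
  qed
  ultimately show ?thesis by (simp add: subshift_hom_def)
qed

section \<open>Equivariant maximal separated sets\<close>

text \<open>
  For \<open>d \<noteq> \<one>\<close> aperiodicity says that every \<open>x\<close> differs from \<open>view x d\<close> at some site \<open>w\<close>. For a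
  fixed \<open>w\<close> this is an open condition on \<open>x\<close>, so by compactness of \<open>X\<close> finitely many sites suffice
  for all points simultaneously.
\<close>

lemma aperiodic_separating_window:
  assumes ap: "aperiodic G X" and D: "finite D" "D \<subseteq> carrier G"
  obtains W where "finite W" and "W \<subseteq> carrier G"
    and "\<And>x d. \<lbrakk>x \<in> X; d \<in> D; restrict x W = restrict (view x d) W\<rbrakk> \<Longrightarrow> d = \<one>"
proof -
  have single: "\<exists>W. finite W \<and> W \<subseteq> carrier G \<and>
      (\<forall>x\<in>X. restrict x W = restrict (view x d) W \<longrightarrow> d = \<one>)" if d: "d \<in> carrier G" for d
  proof (cases "d = \<one>")
    case False
    define Z where "Z w = {x \<in> carrier G \<rightarrow>\<^sub>E A. x w \<noteq> x (d \<otimes> w)}" for w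
    have "openin (full_shift_top G A) (Z w)" if "w \<in> carrier G" for w
    proof (subst openin_subopen, clarify)
      fix x assume x: "x \<in> Z w"
      let ?C = "{y \<in> carrier G \<rightarrow>\<^sub>E A. \<forall>v\<in>{w, d \<otimes> w}. y v = x v}"
      have "openin (full_shift_top G A) ?C"
        using x d that by (intro cylinder_open) (auto simp: Z_def)
      moreover have "x \<in> ?C" "?C \<subseteq> Z w" using x by (auto simp: Z_def)
      ultimately show "\<exists>T. openin (full_shift_top G A) T \<and> x \<in> T \<and> T \<subseteq> Z w" by blast
    qed
    moreover have "X \<subseteq> \<Union> (Z ` carrier G)"
    proof
      fix x assume x: "x \<in> X"
      have "shift G (inv d) x \<noteq> x"
        using ap x False d unfolding aperiodic_def aperiodic_point_def
        by (metis inv_closed inv_eq_1_iff)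
      then have "view x d \<noteq> x" by (simp add: view_def)
      then obtain w where w: "view x d w \<noteq> x w" by blast
      have "x \<in> extensional (carrier G)" using x X_subset_full by (auto simp: PiE_def)
      then have "w \<in> carrier G"
        using w by (auto simp: view_def shift_def extensional_def split: if_splits)
      then show "x \<in> \<Union> (Z ` carrier G)"
        using w x d X_subset_full by (auto simp: Z_def view_apply intro!: bexI[of _ w])
    qed
    ultimately obtain \<F> where \<F>: "finite \<F>" "\<F> \<subseteq> Z ` carrier G" "X \<subseteq> \<Union> \<F>"
      using compactinD[OF compact_X, of "Z ` carrier G"] by blast
    then obtain W where W: "W \<subseteq> carrier G" "finite W" "\<F> = Z ` W"
      using finite_subset_image by metis
    have "restrict x W \<noteq> restrict (view x d) W" if "x \<in> X" for x
    proof
      assume eq: "restrict x W = restrict (view x d) W"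
      have "x \<in> \<Union> (Z ` W)" using that \<F>(3) W(3) by auto
      then obtain w where w: "w \<in> W" "x \<in> Z w" by auto
      then have "w \<in> carrier G" using W by blast
      then have "x w = x (d \<otimes> w)"
        using fun_cong[OF eq, of w] d w by (simp add: view_apply)
      then show False using w by (simp add: Z_def)
    qed
    then have "\<forall>x\<in>X. restrict x W = restrict (view x d) W \<longrightarrow> d = \<one>" by blast
    then show ?thesis using W(1,2) by blast
  qed auto
  then have "\<forall>d\<in>D. \<exists>W. finite W \<and> W \<subseteq> carrier G \<and>
      (\<forall>x\<in>X. restrict x W = restrict (view x d) W \<longrightarrow> d = \<one>)"
    using D by blast
  from bchoice[OF this] obtain f where f: "\<And>d. d \<in> D \<Longrightarrow> finite (f d) \<and> f d \<subseteq> carrier G \<and>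
      (\<forall>x\<in>X. restrict x (f d) = restrict (view x d) (f d) \<longrightarrow> d = \<one>)"
    by blast
  show ?thesis
  proof
    show "finite (\<Union> (f ` D))" "\<Union> (f ` D) \<subseteq> carrier G" using f D by blast+
    fix x d
    assume xd: "x \<in> X" "d \<in> D" "restrict x (\<Union> (f ` D)) = restrict (view x d) (\<Union> (f ` D))"
    have "x w = view x d w" if "w \<in> f d" for w
    proof -
      have "w \<in> \<Union> (f ` D)" using that xd by blast
      then show ?thesis using fun_cong[OF xd(3), of w] by simp
    qed
    then have "restrict x (f d) = restrict (view x d) (f d)" by (auto intro!: restrict_ext)
    then show "d = \<one>" using f xd by blast
  qed
qed

text \<open>
  The contents of a separating window are used as colours of the sites: two distinct sites that
  differ by an element of \<open>D\<close> never share a colour. Hence, when the colours are treated one at a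
  time, all sites of the current colour that satisfy \<open>U\<close> and are not blocked by an earlier choice
  can be added at once, and whether this happens is decided locally.
\<close>

lemma maximal_separated:
  assumes ap: "aperiodic G X" and D: "finite D" "D \<subseteq> carrier G" "\<one> \<in> D"
    and D_inv: "\<And>d. d \<in> D \<Longrightarrow> inv d \<in> D" and U: "local U"
  obtains P where "local P" and "\<And>x. \<lbrakk>x \<in> X; P x\<rbrakk> \<Longrightarrow> U x"
    and "\<And>x d. \<lbrakk>x \<in> X; P x; d \<in> D; P (view x d)\<rbrakk> \<Longrightarrow> d = \<one>"
    and "\<And>x. \<lbrakk>x \<in> X; U x\<rbrakk> \<Longrightarrow> \<exists>d\<in>D. P (view x d)"
proof -
  obtain W where W: "finite W" "W \<subseteq> carrier G"
    and sep: "\<And>x d. \<lbrakk>x \<in> X; d \<in> D; restrict x W = restrict (view x d) W\<rbrakk> \<Longrightarrow> d = \<one>"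
    using aperiodic_separating_window[OF ap D(1,2)] by blast
  let ?c = "\<lambda>x. restrict x W"
  have "\<exists>P. local P \<and> (\<forall>x\<in>X. P x \<longrightarrow> U x) \<and>
      (\<forall>x\<in>X. \<forall>d\<in>D. P x \<and> P (view x d) \<longrightarrow> d = \<one>) \<and>
      (\<forall>x\<in>X. U x \<and> ?c x \<in> Q \<longrightarrow> (\<exists>d\<in>D. P (view x d)))"
    (is "\<exists>P. ?good Q P") if "finite Q" for Q
    using that
  proof (induction Q)
    case empty
    show ?case by (intro exI[of _ "\<lambda>_. False"]) (simp add: local_const)
  next
    case (insert q Q)
    then obtain P where P: "local P" "\<forall>x\<in>X. P x \<longrightarrow> U x"
      "\<forall>x\<in>X. \<forall>d\<in>D. P x \<and> P (view x d) \<longrightarrow> d = \<one>"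
      "\<forall>x\<in>X. U x \<and> ?c x \<in> Q \<longrightarrow> (\<exists>d\<in>D. P (view x d))" by blast
    \<comment> \<open>the sites added when the colour \<open>q\<close> is treated\<close>
    define N where "N x \<longleftrightarrow> U x \<and> ?c x = q \<and> (\<forall>d\<in>D. \<not> P (view x d))" for x
    define P' where "P' x \<longleftrightarrow> P x \<or> N x" for x
    have "local P'"
    proof (rule local_rule)
      show "local (\<lambda>x. (P x, U x, ?c x))"
        by (intro local_pair P U local_restrict W)
      fix x y assume xy: "x \<in> X" "y \<in> X"
        and "\<And>d. d \<in> D \<Longrightarrow> (P (view x d), U (view x d), ?c (view x d))
          = (P (view y d), U (view y d), ?c (view y d))"
      then have eq: "\<And>d. d \<in> D \<Longrightarrow> P (view x d) = P (view y d)"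
        "U x = U y" "?c x = ?c y"
        using D(3) view_one by fastforce+
      from eq(1)[OF D(3)] have "P x = P y" using xy view_one by simp
      then show "P' x = P' y" using eq by (auto simp: P'_def N_def)
    qed (use D in auto)
    moreover have "\<forall>x\<in>X. P' x \<longrightarrow> U x" using P by (auto simp: P'_def N_def)
    moreover have "d = \<one>" if x: "x \<in> X" and d: "d \<in> D" and PP: "P' x" "P' (view x d)" for x d
    proof -
      have dG: "d \<in> carrier G" using d D by blast
      have "\<not> (P x \<and> N (view x d))"
        using D_inv[OF d] view_inv_cancel[OF x dG] unfolding N_def by metis
      moreover have "\<not> (N x \<and> P (view x d))" using d by (auto simp: N_def)
      moreover have "d = \<one>" if "P x" "P (view x d)" using P(3) x d that by blast
      moreover have "d = \<one>" if "N x" "N (view x d)" using sep x d that by (auto simp: N_def)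
      ultimately show ?thesis using PP unfolding P'_def by blast
    qed
    moreover have "\<exists>d\<in>D. P' (view x d)" if x: "x \<in> X" and "U x" "?c x \<in> insert q Q" for x
    proof (cases "\<exists>d\<in>D. P (view x d)")
      case False
      then have "N x" using P(4) x that by (auto simp: N_def)
      then show ?thesis using D(3) view_one[OF x] by (force simp: P'_def)
    qed (auto simp: P'_def)
    ultimately show ?case by blast
  qed
  note maximal_among_colours = this
  have "finite (W \<rightarrow>\<^sub>E A)"
    using W subshift by (auto simp: subshift_def intro!: finite_PiE)
  from maximal_among_colours[OF this] obtain P where P: "?good (W \<rightarrow>\<^sub>E A) P" ..
  have "?c x \<in> W \<rightarrow>\<^sub>E A" if "x \<in> X" for x
    using that X_subset_full W by (auto simp: PiE_iff subset_iff)
  then show ?thesis using that[of P] P by blast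
qed

end

section \<open>Covering by boundedly many separated families of balls\<close>

locale subshift_with_balls = group_subshift G A X + ball_system G b
  for G :: "('g, 'm) monoid_scheme" (structure) and A :: "'a set" and X b
begin

text \<open>
  The families are chosen greedily, each one maximal \<open>6 r\<close>-separated among the sites that the balls
  of radius \<open>2 r\<close> of the earlier families leave uncovered. If a site is uncovered after \<open>M\<close> steps,
  then by maximality each family has a centre within distance \<open>6 r\<close> of it, and centres of different
  families are more than \<open>2 r\<close> apart. The balls of radius \<open>r\<close> about these \<open>M\<close> centres are then
  disjoint and lie in the ball of radius \<open>7 r\<close> about the site, against the bound on \<open>b (8 * r)\<close>.
\<close>

lemma separated_ball_cover:
  assumes ap: "aperiodic G X" and doubling: "card (b (8 * r)) < M * card (b r)"
  obtains P where "\<And>i. i < M \<Longrightarrow> local (P i)"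
    and "\<And>i x d. \<lbrakk>i < M; x \<in> X; P i x; d \<in> b (6 * r); P i (view x d)\<rbrakk> \<Longrightarrow> d = \<one>"
    and "\<And>x. x \<in> X \<Longrightarrow> \<exists>i<M. \<exists>d\<in>b (2 * r). P i (view x d)"
proof -
  have "\<exists>P. (\<forall>i<m. local (P i)) \<and>
      (\<forall>i<m. \<forall>x\<in>X. \<forall>d\<in>b (6 * r). P i x \<and> P i (view x d) \<longrightarrow> d = \<one>) \<and>
      (\<forall>i j. i < j \<and> j < m \<longrightarrow> (\<forall>x\<in>X. \<forall>d\<in>b (2 * r). \<not> (P i x \<and> P j (view x d)))) \<and>
      (\<forall>x\<in>X. (\<exists>i<m. \<exists>d\<in>b (2 * r). P i (view x d)) \<or> (\<forall>i<m. \<exists>d\<in>b (6 * r). P i (view x d)))"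
    (is "\<exists>P. ?good m P") for m :: nat
  proof (induction m)
    case 0
    show ?case by simp
  next
    case (Suc m)
    from Suc.IH obtain P where P: "?good m P" ..
    note P_local = P[THEN conjunct1]
      and P_sep = P[THEN conjunct2, THEN conjunct1]
      and P_disj = P[THEN conjunct2, THEN conjunct2, THEN conjunct1]
      and P_max = P[THEN conjunct2, THEN conjunct2, THEN conjunct2]
    define U where "U x \<longleftrightarrow> \<not> (\<exists>i<m. \<exists>d\<in>b (2 * r). P i (view x d))" for x
    \<comment> \<open>The set of families with a centre at the origin records finitely many local predicates
      in one local function.\<close>
    have "local (\<lambda>x. {i. i < m \<and> P i x})"
    proof -
      have "local (\<lambda>x. {i. i < k \<and> P i x})" if "k \<le> m" for k
        using that
      proof (induction k)
        case (Suc k)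
        have "local (\<lambda>x. ({i. i < k \<and> P i x}, P k x))"
          using Suc P_local by (intro local_pair) auto
        then show ?case
        proof (rule local_rule[where D = "{\<one>}"])
          fix x y assume xy: "x \<in> X" "y \<in> X"
            and "\<And>d. d \<in> {\<one>} \<Longrightarrow> ({i. i < k \<and> P i (view x d)}, P k (view x d))
              = ({i. i < k \<and> P i (view y d)}, P k (view y d))"
          from this(3)[of \<one>] have "{i. i < k \<and> P i x} = {i. i < k \<and> P i y}" "P k x = P k y"
            using xy by (auto simp: view_one)
          then show "{i. i < Suc k \<and> P i x} = {i. i < Suc k \<and> P i y}"
            by (auto simp: less_Suc_eq set_eq_iff)
        qed auto
      qed (simp add: local_const)
      then show ?thesis by simp
    qed
    then have "local U"
    proof (rule local_rule[where D = "b (2 * r)"])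
      fix x y
      assume "\<And>d. d \<in> b (2 * r) \<Longrightarrow>
        {i. i < m \<and> P i (view x d)} = {i. i < m \<and> P i (view y d)}"
      then show "U x = U y" by (auto simp: U_def set_eq_iff)
    qed (auto simp: ball_finite ball_mem_carrier)
    then obtain N where N: "local N" "\<And>x. \<lbrakk>x \<in> X; N x\<rbrakk> \<Longrightarrow> U x"
      "\<And>x d. \<lbrakk>x \<in> X; N x; d \<in> b (6 * r); N (view x d)\<rbrakk> \<Longrightarrow> d = \<one>"
      "\<And>x. \<lbrakk>x \<in> X; U x\<rbrakk> \<Longrightarrow> \<exists>d\<in>b (6 * r). N (view x d)"
      using maximal_separated[OF ap ball_finite ball_carrier ball_one ball_inv] by blast
    have new: "\<not> (P i x \<and> N (view x d))" if "i < m" "x \<in> X" "d \<in> b (2 * r)" for i x d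
    proof
      assume PN: "P i x \<and> N (view x d)"
      have dG: "d \<in> carrier G" using that ball_carrier by blast
      have "U (view x d)" using N(2) PN view_in that dG by blast
      moreover have "P i (view (view x d) (inv d))" using PN view_inv_cancel that dG by simp
      ultimately show False using that ball_inv unfolding U_def by blast
    qed
    have "?good (Suc m) (P(m := N))"
    proof (intro conjI, goal_cases)
      case 1
      then show ?case using P_local N(1) by (auto simp: less_Suc_eq)
    next
      case 2
      then show ?case using P_sep N(3) by (auto simp: less_Suc_eq)
    next
      case 3
      then show ?case using P_disj new by (auto simp: less_Suc_eq)
    next
      case 4
      show ?case
      proof
        fix x assume x: "x \<in> X"
        show "(\<exists>i<Suc m. \<exists>d\<in>b (2 * r). (P(m := N)) i (view x d)) \<or>
          (\<forall>i<Suc m. \<exists>d\<in>b (6 * r). (P(m := N)) i (view x d))"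
        proof (cases "U x")
          case True
          then have "\<forall>i<m. \<exists>d\<in>b (6 * r). P i (view x d)" using P_max x unfolding U_def by blast
          moreover have "\<exists>d\<in>b (6 * r). N (view x d)" using N(4) x True by blast
          ultimately show ?thesis by (auto simp: less_Suc_eq)
        next
          case False
          then obtain i d where "i < m" "d \<in> b (2 * r)" "P i (view x d)"
            unfolding U_def by blast
          then have "\<exists>d\<in>b (2 * r). (P(m := N)) i (view x d)" "i < Suc m" by auto
          then show ?thesis by blast
        qed
      qed
    qed
    then show ?case by (rule exI[of "?good (Suc m)" "P(m := N)"])
  qed
  from this[of M] obtain P where P: "?good M P" ..
  note P_local = P[THEN conjunct1]
    and P_sep = P[THEN conjunct2, THEN conjunct1]
    and P_disj = P[THEN conjunct2, THEN conjunct2, THEN conjunct1]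
    and P_max = P[THEN conjunct2, THEN conjunct2, THEN conjunct2]
  have "\<exists>i<M. \<exists>d\<in>b (2 * r). P i (view x d)" if x: "x \<in> X" for x
  proof (rule ccontr)
    assume "\<not> ?thesis"
    then have "\<forall>i<M. \<exists>d\<in>b (6 * r). P i (view x d)" using P_max x by blast
    then obtain p where p: "\<And>i. i < M \<Longrightarrow> p i \<in> b (6 * r) \<and> P i (view x (p i))" by metis
    have pG: "p i \<in> carrier G" if "i < M" for i using p that ball_carrier by blast
    have disj: "p i \<otimes> u \<noteq> p j \<otimes> v" if ij: "i < j" "j < M" and uv: "u \<in> b r" "v \<in> b r" for i j u v
    proof
      assume eq: "p i \<otimes> u = p j \<otimes> v"
      have mem: "p i \<in> carrier G" "p j \<in> carrier G" "u \<in> carrier G" "v \<in> carrier G"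
        using pG ij uv ball_carrier by auto
      have "inv (p i) \<otimes> p j = u \<otimes> inv v"
        using eq mem by (metis inv_closed inv_solve_left inv_solve_right m_assoc m_closed)
      moreover have "u \<otimes> inv v \<in> b (2 * r)" using ball_mult ball_inv uv by (metis mult_2)
      ultimately have d: "inv (p i) \<otimes> p j \<in> b (2 * r)" by simp
      have "view (view x (p i)) (inv (p i) \<otimes> p j) = view x (p j)"
        using mem by (simp add: view_view flip: m_assoc)
      moreover have "P i (view x (p i))" "P j (view x (p j))" using p ij by auto
      moreover have "\<not> (P i (view x (p i)) \<and> P j (view (view x (p i)) (inv (p i) \<otimes> p j)))"
        using P_disj[rule_format, OF conjI[OF ij] view_in[OF x mem(1)] d] .
      ultimately show False by simp
    qed
    have "M * card (b r) = card (\<Union>i<M. (\<otimes>) (p i) ` b r)"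
    proof (subst card_UN_disjoint)
      have "card ((\<otimes>) (p i) ` b r) = card (b r)" if "i < M" for i
        using inj_on_subset[OF inj_on_cmult[OF pG[OF that]] ball_carrier] by (rule card_image)
      then show "M * card (b r) = (\<Sum>i<M. card ((\<otimes>) (p i) ` b r))" by simp
      show "\<forall>i\<in>{..<M}. \<forall>j\<in>{..<M}. i \<noteq> j \<longrightarrow> (\<otimes>) (p i) ` b r \<inter> (\<otimes>) (p j) ` b r = {}"
      proof (intro ballI impI equals0I)
        fix i j z assume "i \<in> {..<M}" "j \<in> {..<M}" "i \<noteq> j"
          and "z \<in> (\<otimes>) (p i) ` b r \<inter> (\<otimes>) (p j) ` b r"
        then obtain u v where uv: "p i \<otimes> u = p j \<otimes> v" "u \<in> b r" "v \<in> b r" and "i < M" "j < M"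
          by auto
        then show False
          using disj[of i j u v] disj[of j i v u] \<open>i \<noteq> j\<close> by (metis nat_neq_iff)
      qed
    qed (auto simp: ball_finite)
    also have "\<dots> \<le> card (b (8 * r))"
    proof (rule card_mono[OF ball_finite], clarify)
      fix i u assume "i < M" "u \<in> b r"
      then have "p i \<otimes> u \<in> b (6 * r + r)" using p ball_mult by blast
      then show "p i \<otimes> u \<in> b (8 * r)" using ball_mono[of "6 * r + r" "8 * r"] by auto
    qed
    finally show False using doubling by simp
  qed
  then show ?thesis using that P_local P_sep by blast
qed

end

section \<open>Filling a configuration family by family\<close>

text \<open>
  In terms of a total configuration \<open>v\<close> the finite extension property reads: if no forbidden pattern
  of \<open>v\<close> is anchored in \<open>S\<close>, then the restriction of \<open>v\<close> to \<open>S\<close> occurs in a point of \<open>Y\<close>. Total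
  configurations are more convenient below than patterns, because the values outside the region
  under control can be left arbitrary.
\<close>

lemma (in group) FEP_extension:
  assumes "FEP G B Y"
  obtains K F where "finite K" and "K \<subseteq> carrier G" and "\<one> \<in> K"
    and "Y = {y \<in> carrier G \<rightarrow>\<^sub>E B. \<forall>g\<in>carrier G. (\<lambda>k\<in>K. y (g \<otimes> k)) \<notin> F}"
    and "\<And>S v. \<lbrakk>S \<subseteq> carrier G; v \<in> carrier G \<rightarrow> B; \<And>g. g \<in> S \<Longrightarrow> (\<lambda>k\<in>K. v (g \<otimes> k)) \<notin> F\<rbrakk>
      \<Longrightarrow> \<exists>y\<in>Y. \<forall>s\<in>S. y s = v s"
proof -
  from assms[unfolded FEP_def] obtain K F
    where K: "finite K" "K \<subseteq> carrier G" "\<one> \<in> K" and "F \<subseteq> (K \<rightarrow>\<^sub>E B)"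
      and Y: "Y = forbidden_shift G B K F"
      and ext: "\<forall>S w. S \<subseteq> carrier G \<and> w \<in> (S \<rightarrow>\<^sub>E B) \<and>
           (\<exists>w' \<in> (S <#> K) \<rightarrow>\<^sub>E B. restrict w' S = w \<and>
              (\<forall>g\<in>S. translate G (inv g) (g <# K) (restrict w' (g <# K)) \<notin> F))
           \<longrightarrow> (\<exists>x\<in>Y. restrict x S = w)"
    by (elim exE conjE) (rule that)
  have pat: "restrict (shift G g y) K = (\<lambda>k\<in>K. y (inv g \<otimes> k))" for g :: 'a and y :: "'a \<Rightarrow> 'c"
    using K by (auto simp: shift_def restrict_def fun_eq_iff)
  have "Y = {y \<in> carrier G \<rightarrow>\<^sub>E B. \<forall>g\<in>carrier G. (\<lambda>k\<in>K. y (g \<otimes> k)) \<notin> F}"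
  proof -
    have "(\<forall>g\<in>carrier G. R (inv g)) \<longleftrightarrow> (\<forall>g\<in>carrier G. R g)" for R
      by (metis inv_closed inv_inv)
    from this[of "\<lambda>g. (\<lambda>k\<in>K. y (g \<otimes> k)) \<notin> F" for y] show ?thesis
      unfolding Y forbidden_shift_def pat by simp
  qed
  moreover have "\<exists>y\<in>Y. \<forall>s\<in>S. y s = v s"
    if S: "S \<subseteq> carrier G" and v: "v \<in> carrier G \<rightarrow> B"
      and ok: "\<And>g. g \<in> S \<Longrightarrow> (\<lambda>k\<in>K. v (g \<otimes> k)) \<notin> F" for S v
  proof -
    let ?w' = "restrict v (S <#> K)"
    have SK: "S <#> K \<subseteq> carrier G" using S K(2) by (rule set_mult_closed)
    have sub: "S \<subseteq> S <#> K" using S K by (force simp: set_mult_def)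
    have tr: "translate G (inv g) (g <# K) (restrict ?w' (g <# K)) = (\<lambda>k\<in>K. v (g \<otimes> k))"
      if g: "g \<in> S" for g
    proof -
      have gG: "g \<in> carrier G" using g S by blast
      have "inv g <# (g <# K) = K" using gG K by (simp add: lcos_m_assoc lcos_mult_one)
      moreover have "g \<otimes> k \<in> g <# K \<and> g \<otimes> k \<in> S <#> K" if "k \<in> K" for k
        using g that by (auto simp: l_coset_def set_mult_def)
      ultimately show ?thesis using gG by (auto simp: translate_def fun_eq_iff)
    qed
    have "\<exists>y\<in>Y. restrict y S = restrict v S"
    proof (rule ext[rule_format], intro conjI bexI[of _ ?w'] ballI)
      show "restrict ?w' S = restrict v S" using sub by (auto simp: restrict_def fun_eq_iff)
    qed (use S v SK ok tr in auto)
    then show ?thesis by (metis restrict_apply')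
  qed
  ultimately show ?thesis using that K by blast
qed

context subshift_with_balls
begin

text \<open>
  One stage of the construction. \<open>T\<close> marks the sites treated so far, and by assumption no forbidden
  pattern is anchored within distance \<open>n + 1\<close> of them; the conclusion is the same with distance
  \<open>n\<close>, after the balls of radius \<open>r\<close> about the centres \<open>P\<close> have been treated too.

  The sites within distance \<open>n + 1\<close> of \<open>T\<close> are called protected (\<open>S\<close>). Around each centre the new
  configuration copies, on the ball \<open>Q\<close> of radius \<open>r + n + 1\<close>, a point of \<open>Y\<close> that agrees with the
  old configuration at all protected sites of a slightly larger ball \<open>L\<close>; everywhere else the old
  values remain. Consider a pattern anchored within distance \<open>n\<close> of a treated site. If it misses
  all the balls \<open>Q\<close>, it is an old pattern anchored near \<open>T\<close>. If it meets the ball about \<open>p\<close>, it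
  meets no other by separation, and lies inside the \<open>L\<close>-ball of \<open>p\<close>; the sites outside \<open>Q\<close> that it
  reads are protected, so the whole pattern occurs in the point of \<open>Y\<close> chosen at \<open>p\<close>.
\<close>

lemma fill_separated_balls:
  fixes V :: "('g \<Rightarrow> 'a) \<Rightarrow> 'b"
  assumes K: "K \<subseteq> b 1" "\<one> \<in> K"
    and Y: "Y = {y \<in> carrier G \<rightarrow>\<^sub>E B. \<forall>g\<in>carrier G. (\<lambda>k\<in>K. y (g \<otimes> k)) \<notin> F}"
    and ext: "\<And>S v. \<lbrakk>S \<subseteq> carrier G; v \<in> carrier G \<rightarrow> B;
        \<And>g. g \<in> S \<Longrightarrow> (\<lambda>k\<in>K. v (g \<otimes> k)) \<notin> F\<rbrakk> \<Longrightarrow> \<exists>y\<in>Y. \<forall>s\<in>S. y s = v s"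
    and T: "local T" and V: "local V" and VB: "\<And>x. x \<in> X \<Longrightarrow> V x \<in> B"
    and V_ok: "\<And>x s. \<lbrakk>x \<in> X; T x; s \<in> b (Suc n)\<rbrakk> \<Longrightarrow> (\<lambda>k\<in>K. V (view x (s \<otimes> k))) \<notin> F"
    and P: "local P"
    and P_sep: "\<And>x d. \<lbrakk>x \<in> X; P x; d \<in> b (2 * r + 2 * n + 4); P (view x d)\<rbrakk> \<Longrightarrow> d = \<one>"
  obtains V' :: "('g \<Rightarrow> 'a) \<Rightarrow> 'b" where "local V'" and "\<And>x. x \<in> X \<Longrightarrow> V' x \<in> B"
    and "\<And>x s. \<lbrakk>x \<in> X; T x \<or> (\<exists>d\<in>b r. P (view x d)); s \<in> b n\<rbrakk> \<Longrightarrow>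
      (\<lambda>k\<in>K. V' (view x (s \<otimes> k))) \<notin> F"
proof -
  define Q where "Q = b (r + n + 1)"
  define L where "L = b (r + n + 3)"
  have QG: "Q \<subseteq> carrier G" and LG: "L \<subseteq> carrier G" and KG: "K \<subseteq> carrier G"
    using ball_carrier K by (auto simp: Q_def L_def)
  define S where "S x \<longleftrightarrow> (\<exists>s\<in>b (Suc n). T (view x s))" for x
  \<comment> \<open>the point of \<open>Y\<close> copied around a centre\<close>
  define E where "E x = (SOME y. y \<in> Y \<and> (\<forall>l\<in>L. S (view x l) \<longrightarrow> y l = V (view x l)))" for x
  \<comment> \<open>position, relative to the origin, of the only centre whose ball \<open>Q\<close> contains the origin\<close>
  define c where "c x = (SOME d. d \<in> Q \<and> P (view x d))" for x
  define V' where "V' x = (if \<exists>d\<in>Q. P (view x d) then E (view x (c x)) (inv (c x)) else V x)" for x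
  have E: "E x \<in> Y" "\<And>l. \<lbrakk>l \<in> L; S (view x l)\<rbrakk> \<Longrightarrow> E x l = V (view x l)" if x: "x \<in> X" for x
  proof -
    have "\<exists>y\<in>Y. \<forall>s\<in>{g \<in> carrier G. S (view x g)}. y s = V (view x s)"
    proof (rule ext)
      show "(\<lambda>g. V (view x g)) \<in> carrier G \<rightarrow> B" using VB view_in x by auto
      fix g assume "g \<in> {g \<in> carrier G. S (view x g)}"
      then obtain s where g: "g \<in> carrier G" and s: "s \<in> b (Suc n)" "T (view (view x g) s)"
        by (auto simp: S_def)
      have sG: "s \<in> carrier G" using s ball_carrier by blast
      have "view x (g \<otimes> s) \<in> X" using view_in x g sG by simp
      moreover have "T (view x (g \<otimes> s))" using s g sG by (simp add: view_view)
      ultimately have "(\<lambda>k\<in>K. V (view (view x (g \<otimes> s)) (inv s \<otimes> k))) \<notin> F"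
        using V_ok ball_inv s by blast
      moreover have "view (view x (g \<otimes> s)) (inv s \<otimes> k) = view x (g \<otimes> k)" if "k \<in> K" for k
        using that KG g sG by (auto simp: view_view m_assoc mult_inv_cancel subset_iff)
      ultimately show "(\<lambda>k\<in>K. V (view x (g \<otimes> k))) \<notin> F" by (simp cong: restrict_cong)
    qed auto
    then have "\<exists>y. y \<in> Y \<and> (\<forall>l\<in>L. S (view x l) \<longrightarrow> y l = V (view x l))" using LG by blast
    then have "E x \<in> Y \<and> (\<forall>l\<in>L. S (view x l) \<longrightarrow> E x l = V (view x l))"
      unfolding E_def by (rule someI_ex)
    then show "E x \<in> Y" "\<And>l. \<lbrakk>l \<in> L; S (view x l)\<rbrakk> \<Longrightarrow> E x l = V (view x l)" by auto
  qed
  have V'_centre: "V' x = E (view x d) (inv d)"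
    if x: "x \<in> X" and d: "d \<in> Q" "P (view x d)" for x d
  proof -
    have c: "c x \<in> Q \<and> P (view x (c x))" unfolding c_def by (rule someI_ex) (use d in blast)
    have G: "d \<in> carrier G" "c x \<in> carrier G" using c d QG by auto
    have "inv d \<otimes> c x \<in> b ((r + n + 1) + (r + n + 1))"
      using ball_mult[OF ball_inv] c d(1) unfolding Q_def by blast
    then have "inv d \<otimes> c x \<in> b (2 * r + 2 * n + 4)"
      using ball_mono[of "(r + n + 1) + (r + n + 1)" "2 * r + 2 * n + 4"] by auto
    moreover have "P (view (view x d) (inv d \<otimes> c x))"
      using c G by (simp add: view_view flip: m_assoc)
    ultimately have "inv d \<otimes> c x = \<one>" using P_sep d view_in[OF x] G by blast
    then have "c x = d" using mult_inv_cancel(1)[OF G] G by simp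
    then show ?thesis using d unfolding V'_def by auto
  qed
  show ?thesis
  proof
    have "local S"
      by (rule local_rule[OF T ball_finite ball_carrier, of "Suc n"]) (auto simp: S_def)
    then have "local (\<lambda>x. (S x, V x))" using V by (rule local_pair)
    then have "local E"
    proof (rule local_rule[where D = L])
      fix x y assume "\<And>d. d \<in> L \<Longrightarrow> (S (view x d), V (view x d)) = (S (view y d), V (view y d))"
      then have "(\<lambda>z. z \<in> Y \<and> (\<forall>l\<in>L. S (view x l) \<longrightarrow> z l = V (view x l)))
        = (\<lambda>z. z \<in> Y \<and> (\<forall>l\<in>L. S (view y l) \<longrightarrow> z l = V (view y l)))" by (auto simp: fun_eq_iff)
      then show "E x = E y" unfolding E_def by simp
    qed (use LG in \<open>auto simp: L_def ball_finite\<close>)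
    then have "local (\<lambda>x. (P x, E x, V x))" using P V by (intro local_pair)
    then show "local V'"
    proof (rule local_rule[where D = Q])
      fix x y assume xy: "x \<in> X" "y \<in> X" and "\<And>d. d \<in> Q \<Longrightarrow>
        (P (view x d), E (view x d), V (view x d)) = (P (view y d), E (view y d), V (view y d))"
      then have eq: "\<And>d. d \<in> Q \<Longrightarrow> P (view x d) = P (view y d)"
        "\<And>d. d \<in> Q \<Longrightarrow> E (view x d) = E (view y d)"
        "\<And>d. d \<in> Q \<Longrightarrow> V (view x d) = V (view y d)" by auto
      show "V' x = V' y"
      proof (cases "\<exists>d\<in>Q. P (view x d)")
        case True
        then obtain d where "d \<in> Q" "P (view x d)" by blast
        then show ?thesis
          using eq(1,2)[of d] V'_centre[OF xy(1), of d] V'_centre[OF xy(2), of d] by simp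
      next
        case False
        moreover have "V x = V y" using eq(3)[of \<one>] xy ball_one by (simp add: view_one Q_def)
        ultimately show ?thesis using eq(1) by (auto simp: V'_def)
      qed
    qed (use QG in \<open>auto simp: Q_def ball_finite\<close>)
    show "V' x \<in> B" if x: "x \<in> X" for x
    proof (cases "\<exists>d\<in>Q. P (view x d)")
      case True
      then obtain d where d: "d \<in> Q" "P (view x d)" by blast
      then have "d \<in> carrier G" using QG by blast
      then show ?thesis using V'_centre[OF x d] E(1)[OF view_in[OF x]] Y by auto
    qed (use VB x in \<open>simp add: V'_def\<close>)
  next
    fix x s
    assume x: "x \<in> X" and T': "T x \<or> (\<exists>d\<in>b r. P (view x d))" and s: "s \<in> b n"
    have sG: "s \<in> carrier G" using s ball_carrier by blast
    have sk: "s \<otimes> k \<in> b (Suc n)" if "k \<in> K" for k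
      using ball_mult[OF s, of k 1] that K by auto
    \<comment> \<open>Every site read by the pattern at \<open>s\<close> is protected or lies in a ball being filled.\<close>
    have site: "S (view x (s \<otimes> k)) \<or> (\<exists>d\<in>Q. P (view (view x (s \<otimes> k)) d))" if k: "k \<in> K" for k
    proof -
      have skG: "s \<otimes> k \<in> carrier G" using sk[OF k] ball_carrier by blast
      have i: "inv (s \<otimes> k) \<in> b (Suc n)" using sk[OF k] ball_inv by blast
      from T' show ?thesis
      proof
        assume "T x"
        then have "T (view (view x (s \<otimes> k)) (inv (s \<otimes> k)))" using view_inv_cancel x skG by simp
        then show ?thesis using i unfolding S_def by blast
      next
        assume "\<exists>d\<in>b r. P (view x d)"
        then obtain d where d: "d \<in> b r" "P (view x d)" by blast
        have dG: "d \<in> carrier G" using d ball_carrier by blast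
        have "inv (s \<otimes> k) \<otimes> d \<in> b (Suc n + r)" using ball_mult[OF i d(1)] .
        then have "inv (s \<otimes> k) \<otimes> d \<in> Q" by (simp add: Q_def add.commute)
        moreover have "P (view (view x (s \<otimes> k)) (inv (s \<otimes> k) \<otimes> d))"
          using d skG dG by (simp add: view_view flip: m_assoc)
        ultimately show ?thesis by blast
      qed
    qed
    show "(\<lambda>k\<in>K. V' (view x (s \<otimes> k))) \<notin> F"
    proof (cases "\<exists>k\<in>K. \<exists>d\<in>Q. P (view (view x (s \<otimes> k)) d)")
      case False
      then have "V' (view x (s \<otimes> k)) = V (view x (s \<otimes> k))" if "k \<in> K" for k
        using that by (auto simp: V'_def)
      moreover have "T x"
      proof -
        have "\<not> (\<exists>d\<in>b r. P (view x d))"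
        proof
          assume "\<exists>d\<in>b r. P (view x d)"
          then obtain d where d: "d \<in> b r" "P (view x d)" by blast
          have dG: "d \<in> carrier G" using d ball_carrier by blast
          have "inv s \<otimes> d \<in> b (n + r)" using ball_mult[OF ball_inv[OF s] d(1)] .
          then have "inv s \<otimes> d \<in> Q" using ball_mono[of "n + r" "r + n + 1"] by (auto simp: Q_def)
          moreover have "P (view (view x (s \<otimes> \<one>)) (inv s \<otimes> d))"
            using d sG dG by (simp add: view_view flip: m_assoc)
          ultimately show False using False K by blast
        qed
        then show ?thesis using T' by blast
      qed
      moreover have "s \<in> b (Suc n)" using s ball_mono[of n "Suc n"] by auto
      ultimately show ?thesis using V_ok[OF x, of s] by (simp cong: restrict_cong)
    next
      case True
      then obtain k0 d0 where k0: "k0 \<in> K" and d0: "d0 \<in> Q" "P (view (view x (s \<otimes> k0)) d0)" by blast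
      have G0: "k0 \<in> carrier G" "d0 \<in> carrier G" using k0 d0 KG QG by auto
      \<comment> \<open>the only centre whose ball \<open>Q\<close> the pattern meets\<close>
      define p where "p = s \<otimes> k0 \<otimes> d0"
      have pG: "p \<in> carrier G" using G0 sG by (simp add: p_def)
      have Pp: "P (view x p)" using d0 G0 sG by (simp add: p_def view_view)
      have rel: "inv p \<otimes> (s \<otimes> k) \<in> L" if k: "k \<in> K" for k
      proof -
        have kG: "k \<in> carrier G" using k KG by blast
        have "inv p \<otimes> (s \<otimes> k) = inv d0 \<otimes> (inv k0 \<otimes> k)"
          using G0 kG sG unfolding p_def
          by (simp add: inv_mult_group m_assoc mult_inv_cancel)
        moreover have "inv d0 \<otimes> (inv k0 \<otimes> k) \<in> b ((r + n + 1) + (1 + 1))"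
          using ball_mult[OF ball_inv ball_mult[OF ball_inv]] d0(1) k0 k K(1)
          unfolding Q_def by blast
        ultimately show ?thesis by (simp add: L_def eval_nat_numeral)
      qed
      have val: "V' (view x (s \<otimes> k)) = E (view x p) (inv p \<otimes> s \<otimes> k)" if k: "k \<in> K" for k
      proof -
        have kG: "k \<in> carrier G" using k KG by blast
        have skG: "s \<otimes> k \<in> carrier G" using sG kG by simp
        have xsk: "view x (s \<otimes> k) \<in> X" using view_in x skG by blast
        have assoc: "inv p \<otimes> (s \<otimes> k) = inv p \<otimes> s \<otimes> k" using pG sG kG by (simp add: m_assoc)
        show ?thesis
        proof (cases "\<exists>d\<in>Q. P (view (view x (s \<otimes> k)) d)")
          case True
          then obtain d where d: "d \<in> Q" "P (view (view x (s \<otimes> k)) d)" by blast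
          have dG: "d \<in> carrier G" using d QG by blast
          define q where "q = s \<otimes> k \<otimes> d"
          have qG: "q \<in> carrier G" using skG dG by (simp add: q_def)
          have "inv p \<otimes> (s \<otimes> k) \<otimes> d \<in> b ((r + n + 3) + (r + n + 1))"
            using ball_mult rel[OF k] d(1) unfolding L_def Q_def by blast
          then have "inv p \<otimes> q \<in> b (2 * r + 2 * n + 4)"
            using pG skG dG unfolding q_def by (simp add: m_assoc mult_2 algebra_simps)
          moreover have "P (view (view x p) (inv p \<otimes> q))"
            using d pG qG skG dG by (simp add: view_view q_def flip: m_assoc)
          ultimately have "inv p \<otimes> q = \<one>" using P_sep[OF view_in[OF x pG] Pp] by blast
          then have pq: "q = p" using mult_inv_cancel(1)[OF pG qG] pG by simp
          have "view (view x (s \<otimes> k)) d = view x p" using skG dG pq by (simp add: view_view q_def)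
          moreover have "inv d = inv p \<otimes> (s \<otimes> k)"
            unfolding pq[symmetric] q_def using sG kG dG
            by (simp add: inv_mult_group m_assoc mult_inv_cancel)
          ultimately show ?thesis using V'_centre[OF xsk d] assoc by simp
        next
          case False
          then have "S (view x (s \<otimes> k))" using site[OF k] by blast
          moreover have "view (view x p) (inv p \<otimes> (s \<otimes> k)) = view x (s \<otimes> k)"
            using pG skG by (simp add: view_view flip: m_assoc)
          ultimately have "E (view x p) (inv p \<otimes> (s \<otimes> k)) = V (view x (s \<otimes> k))"
            using E(2)[OF view_in[OF x pG] rel[OF k]] by simp
          then show ?thesis using False assoc by (simp add: V'_def)
        qed
      qed
      have "(\<lambda>k\<in>K. E (view x p) (inv p \<otimes> s \<otimes> k)) \<notin> F"
        using E(1)[OF view_in[OF x pG]] Y pG sG by auto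
      then show ?thesis using val by (simp cong: restrict_cong)
    qed
  qed
qed

text \<open>
  The \<open>M\<close> families are filled one after another. After \<open>m\<close> of them the margin is \<open>M - m\<close>, so it
  reaches \<open>0\<close> exactly when every site has been treated, and then no forbidden pattern is left
  anywhere. The first stage starts from a constant configuration and the empty set of treated
  sites, of which the invariant holds vacuously.
\<close>

lemma hom_of_separated_ball_cover:
  assumes K: "K \<subseteq> b 1" "\<one> \<in> K"
    and Y: "Y = {y \<in> carrier G \<rightarrow>\<^sub>E B. \<forall>g\<in>carrier G. (\<lambda>k\<in>K. y (g \<otimes> k)) \<notin> F}"
    and ext: "\<And>S v. \<lbrakk>S \<subseteq> carrier G; v \<in> carrier G \<rightarrow> B;
        \<And>g. g \<in> S \<Longrightarrow> (\<lambda>k\<in>K. v (g \<otimes> k)) \<notin> F\<rbrakk> \<Longrightarrow> \<exists>y\<in>Y. \<forall>s\<in>S. y s = v s"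
    and B: "B \<noteq> {}"
    and P: "\<And>i. i < M \<Longrightarrow> local (P i)"
    and P_sep: "\<And>i x d. \<lbrakk>i < M; x \<in> X; P i x; d \<in> b (2 * r + 2 * M + 2); P i (view x d)\<rbrakk> \<Longrightarrow> d = \<one>"
    and cover: "\<And>x. x \<in> X \<Longrightarrow> \<exists>i<M. \<exists>d\<in>b r. P i (view x d)"
  shows "\<exists>\<phi>. subshift_hom G A X B Y \<phi>"
proof -
  define T where "T m x \<longleftrightarrow> (\<exists>i<m. \<exists>d\<in>b r. P i (view x d))" for m x
  have T_Suc: "T (Suc m) x \<longleftrightarrow> T m x \<or> (\<exists>d\<in>b r. P m (view x d))" for m x
    by (auto simp: T_def less_Suc_eq)
  have T_local: "local (T m)" if "m \<le> M" for m
    using that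
  proof (induction m)
    case 0
    then show ?case by (simp add: T_def local_const)
  next
    case (Suc m)
    have "local (\<lambda>x. (T m x, P m x))" using Suc P by (intro local_pair) auto
    then show ?case
    proof (rule local_rule[where D = "b r"])
      fix x y assume xy: "x \<in> X" "y \<in> X" and eq: "\<And>d. d \<in> b r \<Longrightarrow>
        (T m (view x d), P m (view x d)) = (T m (view y d), P m (view y d))"
      have "T m x = T m y" using eq[of \<one>] xy ball_one by (simp add: view_one)
      then show "T (Suc m) x = T (Suc m) y" using eq by (auto simp: T_Suc)
    qed (auto simp: ball_finite ball_mem_carrier)
  qed
  have "\<exists>V. local V \<and> (\<forall>x\<in>X. V x \<in> B) \<and>
      (\<forall>x\<in>X. T m x \<longrightarrow> (\<forall>s\<in>b (M - m). (\<lambda>k\<in>K. V (view x (s \<otimes> k))) \<notin> F))" if "m \<le> M" for m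
    using that
  proof (induction m)
    case 0
    obtain \<beta> where "\<beta> \<in> B" using B by blast
    then show ?case by (intro exI[of _ "\<lambda>_. \<beta>"]) (simp add: T_def local_const)
  next
    case (Suc m)
    define n where "n = M - Suc m"
    have n: "M - m = Suc n" "n + 1 \<le> M" using Suc.prems by (auto simp: n_def)
    from Suc.IH[OF Suc_leD[OF Suc.prems], unfolded n(1)] obtain V where V: "local V"
      and VB: "\<forall>x\<in>X. V x \<in> B"
      and V_ok: "\<forall>x\<in>X. T m x \<longrightarrow> (\<forall>s\<in>b (Suc n). (\<lambda>k\<in>K. V (view x (s \<otimes> k))) \<notin> F)"
      by (elim exE conjE)
    have sep: "d = \<one>" if "x \<in> X" "P m x" "d \<in> b (2 * r + 2 * n + 4)" "P m (view x d)" for x d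
      using P_sep[of m x d] that Suc.prems n ball_mono[of "2 * r + 2 * n + 4" "2 * r + 2 * M + 2"]
      by auto
    have "\<exists>V'. local V' \<and> (\<forall>x\<in>X. V' x \<in> B) \<and>
      (\<forall>x\<in>X. T m x \<or> (\<exists>d\<in>b r. P m (view x d)) \<longrightarrow>
        (\<forall>s\<in>b n. (\<lambda>k\<in>K. V' (view x (s \<otimes> k))) \<notin> F))"
    proof (rule fill_separated_balls[where V = V and T = "T m" and P = "P m" and n = n and r = r])
      show "local (T m)" "local (P m)" using T_local P Suc.prems by auto
      show "V x \<in> B" if "x \<in> X" for x using VB that by blast
      show "(\<lambda>k\<in>K. V (view x (s \<otimes> k))) \<notin> F" if "x \<in> X" "T m x" "s \<in> b (Suc n)" for x s
        using V_ok that by blast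
    qed (fact K Y ext V sep | blast)+
    then show ?case unfolding T_Suc n_def .
  qed
  from this[OF order_refl, unfolded diff_self_eq_0] obtain V where V: "local V"
    "\<forall>x\<in>X. V x \<in> B"
    "\<forall>x\<in>X. T M x \<longrightarrow> (\<forall>s\<in>b 0. (\<lambda>k\<in>K. V (view x (s \<otimes> k))) \<notin> F)"
    by (elim exE conjE)
  have "(\<lambda>g\<in>carrier G. V (view x g)) \<in> Y" if x: "x \<in> X" for x
  proof -
    have "(\<lambda>k\<in>K. (\<lambda>g\<in>carrier G. V (view x g)) (g \<otimes> k)) \<notin> F" if g: "g \<in> carrier G" for g
    proof -
      have xg: "view x g \<in> X" using view_in x g by blast
      then have "T M (view x g)" using cover by (simp add: T_def)
      then have "(\<lambda>k\<in>K. V (view (view x g) (\<one> \<otimes> k))) \<notin> F" using V(3) xg ball_one by blast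
      moreover have "K \<subseteq> carrier G" using K ball_carrier by blast
      then have "V (view (view x g) (\<one> \<otimes> k)) = (\<lambda>g\<in>carrier G. V (view x g)) (g \<otimes> k)"
        if "k \<in> K" for k using that g by (auto simp: view_view subset_iff)
      ultimately show ?thesis by (simp cong: restrict_cong)
    qed
    then show ?thesis unfolding Y using V(2) view_in x by auto
  qed
  moreover have "Y \<subseteq> carrier G \<rightarrow>\<^sub>E B" using Y by blast
  ultimately show ?thesis using local_imp_hom[OF V(1)] by blast
qed

end

theorem theorem1p4:
  fixes G :: "('g, 'm) monoid_scheme"
    and A :: "'a set" and X :: "('g \<Rightarrow> 'a) set"
    and B :: "'b set" and Y :: "('g \<Rightarrow> 'b) set"
  assumes "group G" and "countable (carrier G)"
    and "\<And>H. subgroup H G \<Longrightarrow> finitely_generated (G\<lparr>carrier := H\<rparr>)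
            \<Longrightarrow> polynomial_growth (G\<lparr>carrier := H\<rparr>)"
    and "subshift G A X" and "aperiodic G X"
    and "subshift G B Y" and "Y \<noteq> {}" and "FEP G B Y"
  shows "\<exists>\<phi>. subshift_hom G A X B Y \<phi>"
proof -
  interpret group G by fact
  obtain K F where K: "finite K" "K \<subseteq> carrier G" "\<one>\<^bsub>G\<^esub> \<in> K"
    and Y: "Y = {y \<in> carrier G \<rightarrow>\<^sub>E B. \<forall>g\<in>carrier G. (\<lambda>k\<in>K. y (g \<otimes>\<^bsub>G\<^esub> k)) \<notin> F}"
    and ext: "\<And>S v. \<lbrakk>S \<subseteq> carrier G; v \<in> carrier G \<rightarrow> B;
        \<And>g. g \<in> S \<Longrightarrow> (\<lambda>k\<in>K. v (g \<otimes>\<^bsub>G\<^esub> k)) \<notin> F\<rbrakk> \<Longrightarrow> \<exists>y\<in>Y. \<forall>s\<in>S. y s = v s"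
    by (fact FEP_extension[OF assms(8)])
  \<comment> \<open>Patterns of \<open>Y\<close> relate only sites in the same coset of this subgroup, so its word metric is
    the right distance for separating balls.\<close>
  define H where "H = generate G K"
  have H: "subgroup H G" unfolding H_def using K(2) by (rule generate_is_subgroup)
  have KH: "K \<subseteq> H" unfolding H_def by (auto intro: generate.incl)
  have "generate (G\<lparr>carrier := H\<rparr>) K = H"
    using generate_consistent[OF KH H] by (simp add: H_def)
  then have "finitely_generated (G\<lparr>carrier := H\<rparr>)"
    unfolding finitely_generated_def generating_set_def using K KH by auto
  then have growth: "polynomial_growth (G\<lparr>carrier := H\<rparr>)" using assms(3) H by blast
  have KH': "K \<subseteq> carrier (G\<lparr>carrier := H\<rparr>)" using KH by simp
  obtain b M where bH: "ball_system (G\<lparr>carrier := H\<rparr>) b" and Kb: "K \<subseteq> b 1"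
    and doubling: "\<forall>n0. \<exists>n\<ge>n0. card (b (8 * n)) < M * card (b n)"
    by (fact group.polynomial_growth_doubling_balls[OF subgroup_imp_group[OF H] growth K(1) KH'])
  interpret ball_system G b using H bH by (rule ball_system_subgroup)
  interpret subshift_with_balls G A X b by unfold_locales fact
  \<comment> \<open>\<open>r > M\<close> makes \<open>6 r\<close>-separation enough for balls of radius \<open>2 r\<close> with margins up to \<open>M\<close>.\<close>
  obtain r where r: "r \<ge> M + 1" "card (b (8 * r)) < M * card (b r)" using doubling by blast
  obtain P where P: "\<And>i. i < M \<Longrightarrow> local (P i)"
    "\<And>i x d. \<lbrakk>i < M; x \<in> X; P i x; d \<in> b (6 * r); P i (view x d)\<rbrakk> \<Longrightarrow> d = \<one>\<^bsub>G\<^esub>"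
    "\<And>x. x \<in> X \<Longrightarrow> \<exists>i<M. \<exists>d\<in>b (2 * r). P i (view x d)"
    by (fact separated_ball_cover[OF assms(5) r(2)])
  have "b (2 * (2 * r) + 2 * M + 2) \<subseteq> b (6 * r)" using r by (intro ball_mono) simp
  then have P_sep: "\<And>i x d. \<lbrakk>i < M; x \<in> X; P i x; d \<in> b (2 * (2 * r) + 2 * M + 2);
      P i (view x d)\<rbrakk> \<Longrightarrow> d = \<one>\<^bsub>G\<^esub>"
    using P(2) by blast
  have "B \<noteq> {}" using assms(6) by (simp add: subshift_def)
  show ?thesis
    by (rule hom_of_separated_ball_cover[where P = P and M = M and r = "2 * r"])
      (fact Kb K Y ext P P_sep \<open>B \<noteq> {}\<close>)+
qed

end
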